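(* For $n\ge 0$ let $E(n)$ and $O(n)$ be the numbers of partitions of $n$ having even and odd pairing rank, respectively, and let $\operatorname{sc}(n)$ be the number of self-conjugate partitions of $n$. Then for every $n\geq 0$, $$E(n)-O(n)=(-1)^n\operatorname{sc}(n).$$
   Context: For an integer partition $\lambda$, pair equal parts of $\lambda$ as far as possible: for each part size occurring with odd multiplicity exactly one copy remains unpaired, and a part size of even multiplicity is completely paired. Let $r(\lambda)$ be the largest part size that participates in at least one pair (i.e. of multiplicity at least $2$), with $r(\lambda)=0$ if $\lambda$ has distinct parts. Write the unpaired parts (the part sizes of odd multiplicity, each once) in decreasing order $u_1>u_2>\cdots$ and let $s(\lambda)=u_1-u_2+u_3-u_4+\cdots$ (so $s(\lambda)=0$ if there are no unpaired parts). The pairing rank of $\lambda$ is $\rho(\lambda)=r(\lambda)-s(\lambda)$. A partition is self-conjugate if it equals its conjugate (transpose). *)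

theory Defs
  imports "HOL-Library.Multiset"
begin

definition partitions_of :: "nat \<Rightarrow> nat multiset set" where
  "partitions_of n = {P. 0 \<notin># P \<and> sum_mset P = n}"

text \<open>The \<open>j\<close>-th part of the conjugate, for each \<open>j \<ge> 1\<close> not exceeding the largest part,
  is the number of parts of size at least \<open>j\<close>.\<close>

definition conjugate_partition :: "nat multiset \<Rightarrow> nat multiset" where
  "conjugate_partition P =
     image_mset (\<lambda>j. size {#x \<in># P. j \<le> x#}) (mset_set (\<Union>x\<in>set_mset P. {1..x}))"

definition largest_paired_part :: "nat multiset \<Rightarrow> nat" where
  "largest_paired_part P = Max (insert 0 {k \<in> set_mset P. 2 \<le> count P k})"

definition unpaired_parts :: "nat multiset \<Rightarrow> nat list" where
  "unpaired_parts P = rev (sorted_list_of_set {k \<in> set_mset P. odd (count P k)})"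

text \<open>List indices start at 0, so the largest unpaired part gets a positive sign.\<close>

definition unpaired_alternating_sum :: "nat multiset \<Rightarrow> int" where
  "unpaired_alternating_sum P =
     (\<Sum>i<length (unpaired_parts P). (-1) ^ i * int (unpaired_parts P ! i))"

definition pairing_rank :: "nat multiset \<Rightarrow> int" where
  "pairing_rank P = int (largest_paired_part P) - unpaired_alternating_sum P"

definition even_rank_count :: "nat \<Rightarrow> nat" where
  "even_rank_count n = card {P \<in> partitions_of n. even (pairing_rank P)}"

definition odd_rank_count :: "nat \<Rightarrow> nat" where
  "odd_rank_count n = card {P \<in> partitions_of n. odd (pairing_rank P)}"

definition self_conjugate_count :: "nat \<Rightarrow> nat" where
  "self_conjugate_count n = card {P \<in> partitions_of n. conjugate_partition P = P}"

text \<open>Finiteness makes the cardinalities above genuine counts, since \<open>card\<close> is 0 on infinite sets.\<close>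

lemma finite_partitions_of: "finite (partitions_of n)"
proof -
  have size_le: "size P \<le> sum_mset P" if "0 \<notin># P" for P :: "nat multiset"
    using that by (induction P) auto
  have part_le: "x \<le> sum_mset P" if "x \<in># P" for x and P :: "nat multiset"
    using that by (auto dest: multi_member_split)
  have "partitions_of n \<subseteq> mset ` {xs. set xs \<subseteq> {..n} \<and> length xs \<le> n}"
  proof
    fix P
    assume P: "P \<in> partitions_of n"
    obtain xs where xs: "mset xs = P"
      using ex_mset by blast
    have "set xs \<subseteq> {..n}"
      using P part_le xs by (auto simp: partitions_of_def)
    moreover have "length xs \<le> n"
      using P size_le[of P] xs by (auto simp: partitions_of_def)
    ultimately show "P \<in> mset ` {xs. set xs \<subseteq> {..n} \<and> length xs \<le> n}"
      using xs by blast
  qed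
  then show ?thesis
    by (rule finite_subset) (intro finite_imageI finite_lists_length_le, simp)
qed

end

theory Submission
  imports Defs
begin

text \<open>
  Write \<open>P = \<mu> + \<mu> + D\<close> with \<open>D\<close> the set of unpaired parts. Then \<open>s(P)\<close> has the parity of
  the sum of \<open>D\<close>, hence of \<open>n\<close>, and \<open>r(P)\<close> is the largest part of \<open>\<mu>\<close>, so that
  \<open>E(n) - O(n) = (-1)\<^sup>n \<Sum> (-1)\<^bsup>r(P)\<^esup>\<close>. Conjugating \<open>\<mu>\<close> replaces its largest part by its number of
  parts. In the resulting signed sum, exchanging an unpaired \<open>2k\<close> with a pair \<open>k, k\<close>, for the
  least possible \<open>k\<close>, is a sign-reversing involution, whose fixed points are the partitions into
  distinct odd parts. Reading these parts as the diagonal hooks of a symmetric Young diagram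
  identifies them with the self-conjugate partitions.
\<close>

subsection \<open>Young diagrams\<close>

definition down_closed :: "(nat \<times> nat) set \<Rightarrow> bool" where
  "down_closed Y \<longleftrightarrow> (\<forall>i j i' j'. (i, j) \<in> Y \<longrightarrow> i' \<le> i \<longrightarrow> j' \<le> j \<longrightarrow> (i', j') \<in> Y)"

text \<open>Only rows meeting column 0 are listed; for a down-closed \<open>Y\<close> these are
  exactly the nonempty rows.\<close>

definition row_partition :: "(nat \<times> nat) set \<Rightarrow> nat multiset" where
  "row_partition Y = image_mset (\<lambda>i. card {j. (i, j) \<in> Y}) (mset_set {i. (i, 0) \<in> Y})"

text \<open>The Ferrers diagram with decreasing rows and indices from 0, given by its column
  heights, which avoids sorting the parts.\<close>

definition diagram :: "nat multiset \<Rightarrow> (nat \<times> nat) set" where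
  "diagram P = {(i, j). i < size {#x \<in># P. j < x#}}"

lemma down_closedD: "down_closed Y \<Longrightarrow> (i, j) \<in> Y \<Longrightarrow> i' \<le> i \<Longrightarrow> j' \<le> j \<Longrightarrow> (i', j') \<in> Y"
  unfolding down_closed_def by blast

lemma down_closed_converse: "down_closed Y \<Longrightarrow> down_closed (Y\<inverse>)"
  unfolding down_closed_def by blast

text \<open>Such a set is \<open>{..<card S}\<close>. This translates lengths of rows, columns and
  diagonals into membership of cells.\<close>

lemma initial_segment_iff:
  fixes S :: "nat set"
  assumes "finite S" and "\<And>x y. x \<in> S \<Longrightarrow> y \<le> x \<Longrightarrow> y \<in> S"
  shows "x < card S \<longleftrightarrow> x \<in> S"
proof
  assume "x \<in> S"
  with assms(2) have "{..x} \<subseteq> S" by auto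
  with assms(1) have "card {..x} \<le> card S" by (rule card_mono)
  then show "x < card S" by simp
next
  assume *: "x < card S"
  show "x \<in> S"
  proof (rule ccontr)
    assume "x \<notin> S"
    with assms(2) have "S \<subseteq> {..<x}" by (meson lessThan_iff not_le subsetI)
    then have "card S \<le> card {..<x}" by (intro card_mono) auto
    with * show False by simp
  qed
qed

lemma finite_row: "finite Y \<Longrightarrow> finite {j. (i, j) \<in> Y}"
  using finite_Image[of Y "{i}"] by (simp add: Image_def)

lemma finite_column: "finite Y \<Longrightarrow> finite {i. (i, j) \<in> Y}"
  using finite_row[of "Y\<inverse>" j] by simp

lemma less_card_row_iff:
  assumes "finite Y" "down_closed Y"
  shows "j < card {j. (i, j) \<in> Y} \<longleftrightarrow> (i, j) \<in> Y"
  using initial_segment_iff[OF finite_row[OF assms(1)], of i j] down_closedD[OF assms(2)] by auto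

lemma less_card_column_iff:
  assumes "finite Y" "down_closed Y"
  shows "i < card {i. (i, j) \<in> Y} \<longleftrightarrow> (i, j) \<in> Y"
  using initial_segment_iff[OF finite_column[OF assms(1)], of j i] down_closedD[OF assms(2)] by auto

lemma size_filter_image_mset_set:
  "finite A \<Longrightarrow> size {#x \<in># image_mset f (mset_set A). Q x#} = card {a \<in> A. Q (f a)}"
  by (simp add: filter_mset_image_mset)

text \<open>Row \<open>i\<close> is longer than \<open>j\<close> exactly when it contains the cell
  \<open>(i, j)\<close>, so the number of parts exceeding \<open>j\<close> is the height of column
  \<open>j\<close>.\<close>

lemma diagram_row_partition:
  assumes "finite Y" "down_closed Y"
  shows "diagram (row_partition Y) = Y"
proof -
  have "size {#x \<in># row_partition Y. j < x#} = card {i. (i, j) \<in> Y}" for j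
  proof -
    have "{i \<in> {i. (i, 0) \<in> Y}. j < card {j. (i, j) \<in> Y}} = {i. (i, j) \<in> Y}"
      using down_closedD[OF assms(2)] by (auto simp: less_card_row_iff[OF assms])
    then show ?thesis
      unfolding row_partition_def
      by (subst size_filter_image_mset_set) (auto simp: finite_column[OF assms(1)])
  qed
  then show ?thesis
    by (auto simp: diagram_def less_card_column_iff[OF assms])
qed

lemma zero_notin_row_partition:
  assumes "finite Y"
  shows "0 \<notin># row_partition Y"
  using finite_row[OF assms] finite_column[OF assms] by (auto simp: row_partition_def)

lemma sum_row_partition:
  assumes "finite Y" "down_closed Y"
  shows "sum_mset (row_partition Y) = card Y"
proof -
  have "Y = Sigma {i. (i, 0) \<in> Y} (\<lambda>i. {j. (i, j) \<in> Y})"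
    using down_closedD[OF assms(2)] by auto
  then have "card Y = (\<Sum>i | (i, 0) \<in> Y. card {j. (i, j) \<in> Y})"
    using card_SigmaI[of "{i. (i, 0) \<in> Y}" "\<lambda>i. {j. (i, j) \<in> Y}"]
    by (simp add: finite_row[OF assms(1)] finite_column[OF assms(1)])
  then show ?thesis
    by (simp add: row_partition_def sum_unfold_sum_mset)
qed

lemma diagram_first_row: "(0, j) \<in> diagram P \<longleftrightarrow> (\<exists>x\<in>#P. j < x)"
proof -
  have "(0, j) \<in> diagram P \<longleftrightarrow> set_mset {#x \<in># P. j < x#} \<noteq> {}"
    unfolding diagram_def set_mset_eq_empty_iff
    by (simp only: nonempty_has_size mem_Collect_eq case_prod_conv)
  then show ?thesis by auto
qed

lemma down_closed_diagram: "down_closed (diagram P)"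
  unfolding down_closed_def diagram_def
proof clarify
  fix i j i' j' :: nat
  assume *: "i < size {#x \<in># P. j < x#}" "i' \<le> i" "j' \<le> j"
  then have "{#x \<in># P. j < x#} \<subseteq># {#x \<in># P. j' < x#}"
    by (intro filter_mset_mono_strong) auto
  from size_mset_mono[OF this] * show "i' < size {#x \<in># P. j' < x#}" by simp
qed

lemma finite_diagram: "finite (diagram P)"
proof (rule finite_subset)
  show "diagram P \<subseteq> {..<size P} \<times> {..<Max (insert 0 (set_mset P))}"
  proof clarify
    fix i j
    assume "(i, j) \<in> diagram P"
    then have *: "i < size {#x \<in># P. j < x#}" by (simp add: diagram_def)
    have "(0, j) \<in> diagram P"
      using down_closedD[OF down_closed_diagram \<open>(i, j) \<in> diagram P\<close>] by simp
    then have "j < Max (insert 0 (set_mset P))" by (auto simp: Max_gr_iff diagram_first_row)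
    moreover have "i < size P"
      using * size_filter_mset_lesseq[of "(<) j" P] by linarith
    ultimately show "i \<in> {..<size P} \<and> j \<in> {..<Max (insert 0 (set_mset P))}" by auto
  qed
qed simp

text \<open>The diagram fixes the number of parts exceeding each \<open>j\<close>, and consecutive
  differences give the multiplicities of the positive parts. Zero parts leave no cells, hence the
  last two hypotheses.\<close>

lemma diagram_inject:
  assumes "diagram P = diagram Q" "0 \<notin># P" "0 \<notin># Q"
  shows "P = Q"
proof (rule multiset_eqI)
  fix k
  have size_eq: "size {#x \<in># P. j < x#} = size {#x \<in># Q. j < x#}" for j
  proof -
    have "i < size {#x \<in># P. j < x#} \<longleftrightarrow> i < size {#x \<in># Q. j < x#}" for i
      using assms(1) by (auto simp: diagram_def set_eq_iff)
    then show ?thesis by (metis linorder_neqE_nat less_irrefl)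
  qed
  have split: "size {#x \<in># R. j < x#} = count R (Suc j) + size {#x \<in># R. Suc j < x#}" for R j
    by (induction R) auto
  show "count P k = count Q k"
  proof (cases k)
    case 0
    then show ?thesis using assms(2,3) by (simp add: not_in_iff)
  next
    case (Suc j)
    then show ?thesis using split[of j P] split[of j Q] size_eq[of j] size_eq[of k] by simp
  qed
qed

lemma row_partition_diagram:
  assumes "0 \<notin># P"
  shows "row_partition (diagram P) = P"
  using assms
  by (intro diagram_inject diagram_row_partition zero_notin_row_partition
      finite_diagram down_closed_diagram)

lemma card_diagram: "0 \<notin># P \<Longrightarrow> card (diagram P) = sum_mset P"
  using sum_row_partition[OF finite_diagram down_closed_diagram, of P]
  by (simp add: row_partition_diagram)

section \<open>Conjugation as transposition of diagrams\<close>

lemma conjugate_partition_eq: "conjugate_partition P = row_partition ((diagram P)\<inverse>)"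
proof -
  \<comment> \<open>\<open>conjugate_partition\<close> numbers columns from 1, diagrams from 0: the
    index set is shifted by \<open>Suc\<close>, and \<open>Suc j \<le> x\<close> becomes
    \<open>j < x\<close>.\<close>
  have "(\<Union>x\<in>set_mset P. {1..x}) = Suc ` {j. (0, j) \<in> diagram P}"
  proof (intro equalityI subsetI)
    fix y assume "y \<in> (\<Union>x\<in>set_mset P. {1..x})"
    then show "y \<in> Suc ` {j. (0, j) \<in> diagram P}"
      by (cases y) (auto simp: diagram_first_row Suc_le_eq)
  qed (auto simp: diagram_first_row Suc_le_eq)
  then have "mset_set (\<Union>x\<in>set_mset P. {1..x}) =
      image_mset Suc (mset_set {j. (0, j) \<in> diagram P})"
    by (simp add: image_mset_mset_set)
  moreover have "(\<le>) (Suc j) = (<) j" for j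
    by (simp add: fun_eq_iff Suc_le_eq)
  ultimately show ?thesis
    by (simp add: conjugate_partition_def row_partition_def diagram_def multiset.map_comp
        comp_def)
qed

lemma diagram_conjugate_partition: "diagram (conjugate_partition P) = (diagram P)\<inverse>"
  by (simp add: conjugate_partition_eq diagram_row_partition finite_diagram
      down_closed_diagram down_closed_converse)

lemma zero_notin_conjugate_partition: "0 \<notin># conjugate_partition P"
  by (simp add: conjugate_partition_eq zero_notin_row_partition finite_diagram)

lemma sum_conjugate_partition: "0 \<notin># P \<Longrightarrow> sum_mset (conjugate_partition P) = sum_mset P"
  by (simp add: conjugate_partition_eq sum_row_partition finite_diagram down_closed_diagram
      down_closed_converse card_diagram)

lemma conjugate_conjugate_partition:
  "0 \<notin># P \<Longrightarrow> conjugate_partition (conjugate_partition P) = P"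
  by (rule diagram_inject) (simp_all add: diagram_conjugate_partition zero_notin_conjugate_partition)

text \<open>The nonempty columns are those with index below the largest part. The inserted 0 covers
  the empty partition and matches \<open>largest_paired_part\<close>.\<close>

lemma size_conjugate_partition: "size (conjugate_partition P) = Max (insert 0 (set_mset P))"
proof -
  have "{j. (0, j) \<in> diagram P} = {..<Max (insert 0 (set_mset P))}"
    by (auto simp: diagram_first_row Max_gr_iff)
  then show ?thesis by (simp add: conjugate_partition_eq row_partition_def)
qed

subsection \<open>Paired and unpaired parts\<close>

text \<open>The multiset \<mu> of the overview: one representative of each pair.\<close>

definition pairs :: "nat multiset \<Rightarrow> nat multiset" where
  "pairs P = (\<Sum>k\<in>set_mset P. replicate_mset (count P k div 2) k)"

definition singles :: "nat multiset \<Rightarrow> nat set" where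
  "singles P = {k. odd (count P k)}"

lemma count_pairs: "count (pairs P) k = count P k div 2"
proof -
  have "count (pairs P) k = (\<Sum>i\<in>set_mset P. if i = k then count P i div 2 else 0)"
    unfolding pairs_def count_sum by (rule sum.cong) auto
  also have "\<dots> = count P k div 2"
    by (simp add: not_in_iff)
  finally show ?thesis .
qed

lemma singles_subset: "singles P \<subseteq> set_mset P"
  by (auto simp: singles_def intro: count_inI)

lemma finite_singles: "finite (singles P)"
  by (rule finite_subset[OF singles_subset]) simp

lemma count_singles: "count (mset_set (singles P)) k = (if odd (count P k) then 1 else 0)"
  by (simp add: count_mset_set' finite_singles) (simp add: singles_def)

lemma pairs_singles_decomposition: "pairs P + pairs P + mset_set (singles P) = P"
proof (rule multiset_eqI)
  fix k
  have "c div 2 + c div 2 + (if odd c then 1 else 0) = c" for c :: nat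
    by simp presburger
  then show "count (pairs P + pairs P + mset_set (singles P)) k = count P k"
    by (simp only: count_union count_pairs count_singles)
qed

text \<open>Halving \<open>2 * m\<close> or \<open>2 * m + 1\<close> gives \<open>m\<close>. With
  the next lemma this makes the decomposition unique, so the paired half can be altered without
  disturbing the singles.\<close>

lemma pairs_decomposed: "finite D \<Longrightarrow> pairs (M + M + mset_set D) = M"
  by (rule multiset_eqI) (auto simp: count_pairs count_mset_set')

lemma singles_decomposed: "finite D \<Longrightarrow> singles (M + M + mset_set D) = D"
  by (auto simp: singles_def count_mset_set' split: if_splits)

lemma sum_pairs_singles: "2 * sum_mset (pairs P) + \<Sum>(singles P) = sum_mset P"
  by (subst (3) pairs_singles_decomposition[symmetric])
    (simp add: sum_unfold_sum_mset)

lemma set_pairs: "set_mset (pairs P) = {k \<in> set_mset P. 2 \<le> count P k}"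
proof -
  have "k \<in># pairs P \<longleftrightarrow> 2 \<le> count P k" for k
    using count_greater_zero_iff[of "pairs P" k] by (auto simp: count_pairs)
  moreover have "k \<in># P" if "2 \<le> count P k" for k
    using that count_greater_zero_iff[of P k] by linarith
  ultimately show ?thesis by auto
qed

lemma even_unpaired_alternating_sum:
  "even (unpaired_alternating_sum P) \<longleftrightarrow> even (\<Sum>(singles P))"
proof -
  have set: "{k \<in> set_mset P. odd (count P k)} = singles P"
    using singles_subset[of P] by (auto simp: singles_def)
  \<comment> \<open>Signs vanish modulo 2: each term of the difference is 0 or
    \<open>- 2 * int (xs ! i)\<close>.\<close>
  have "even ((\<Sum>i<m. (-1) ^ i * int (xs ! i)) - (\<Sum>i<m. int (xs ! i)))" for m xs
    unfolding sum_subtractf[symmetric] by (rule dvd_sum) auto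
  moreover have "(\<Sum>i<length (unpaired_parts P). int (unpaired_parts P ! i)) = int (\<Sum>(singles P))"
  proof -
    have "(\<Sum>i<length (unpaired_parts P). unpaired_parts P ! i) = sum_list (unpaired_parts P)"
      by (simp add: sum_list_sum_nth atLeast0LessThan)
    also have "\<dots> = \<Sum>(singles P)"
      unfolding unpaired_parts_def set sum_list_rev
      by (simp add: distinct_sum_list_conv_Sum finite_singles)
    finally show ?thesis by (simp flip: of_nat_sum)
  qed
  ultimately show ?thesis
    unfolding unpaired_alternating_sum_def
    by (simp only: even_diff even_add even_of_nat)
qed

text \<open>The pairs contribute an even amount to the sum of all parts, so that sum has the parity
  of the alternating sum; conjugation turns the largest paired part into a number of parts.\<close>

lemma even_pairing_rank_iff:
  "even (pairing_rank P) \<longleftrightarrow> even (size (conjugate_partition (pairs P)) + sum_mset P)"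
proof -
  have "largest_paired_part P = size (conjugate_partition (pairs P))"
    by (simp add: size_conjugate_partition largest_paired_part_def set_pairs)
  moreover have "even (sum_mset P) \<longleftrightarrow> even (\<Sum>(singles P))"
    by (simp flip: sum_pairs_singles[of P])
  ultimately show ?thesis
    by (simp add: pairing_rank_def even_unpaired_alternating_sum)
qed

section \<open>Conjugating the paired half\<close>

definition conjugate_pairs :: "nat multiset \<Rightarrow> nat multiset" where
  "conjugate_pairs P =
     conjugate_partition (pairs P) + conjugate_partition (pairs P) + mset_set (singles P)"

lemma pairs_conjugate_pairs: "pairs (conjugate_pairs P) = conjugate_partition (pairs P)"
  by (simp add: conjugate_pairs_def pairs_decomposed finite_singles)

lemma singles_conjugate_pairs: "singles (conjugate_pairs P) = singles P"
  by (simp add: conjugate_pairs_def singles_decomposed finite_singles)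

lemma zero_notin_pairs: "0 \<notin># P \<Longrightarrow> 0 \<notin># pairs P"
  by (simp add: set_pairs)

lemma conjugate_pairs_involution:
  "0 \<notin># P \<Longrightarrow> conjugate_pairs (conjugate_pairs P) = P"
  by (subst conjugate_pairs_def)
    (simp add: pairs_conjugate_pairs singles_conjugate_pairs conjugate_conjugate_partition
      zero_notin_pairs pairs_singles_decomposition)

lemma conjugate_pairs_in_partitions_of:
  assumes "P \<in> partitions_of n"
  shows "conjugate_pairs P \<in> partitions_of n"
proof -
  have P: "0 \<notin># P" "sum_mset P = n" using assms by (auto simp: partitions_of_def)
  then have "0 \<notin># conjugate_pairs P"
    using singles_subset[of P]
    by (auto simp: conjugate_pairs_def zero_notin_conjugate_partition finite_singles)
  moreover have "sum_mset (conjugate_pairs P) = n"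
    using sum_pairs_singles[of "conjugate_pairs P"] sum_pairs_singles[of P] P
    by (simp add: pairs_conjugate_pairs singles_conjugate_pairs sum_conjugate_partition
        zero_notin_pairs)
  ultimately show ?thesis by (simp add: partitions_of_def)
qed

lemma even_minus_odd_rank_count:
  "int (even_rank_count n) - int (odd_rank_count n) =
     (-1) ^ n * (\<Sum>P\<in>partitions_of n. (-1) ^ size (pairs P))"
proof -
  let ?S = "partitions_of n"
  have "int (even_rank_count n) - int (odd_rank_count n) =
      (\<Sum>P\<in>?S. if even (pairing_rank P) then 1 else 0) -
      (\<Sum>P\<in>?S. if odd (pairing_rank P) then 1 else 0)"
    by (simp add: even_rank_count_def odd_rank_count_def sum.If_cases finite_partitions_of
        Collect_conj_eq Int_commute)
  also have "\<dots> = (\<Sum>P\<in>?S. if even (pairing_rank P) then 1 else -1)"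
    unfolding sum_subtractf[symmetric] by (rule sum.cong) auto
  also have "\<dots> = (\<Sum>P\<in>?S. (-1) ^ n * (-1) ^ size (conjugate_partition (pairs P)))"
    by (rule sum.cong)
      (auto simp: even_pairing_rank_iff partitions_of_def minus_one_power_iff)
  also have "\<dots> = (-1) ^ n * (\<Sum>P\<in>?S. (-1) ^ size (conjugate_partition (pairs P)))"
    by (rule sum_distrib_left[symmetric])
  \<comment> \<open>\<open>conjugate_pairs\<close> permutes the partitions of \<open>n\<close> and
    carries one exponent to the other.\<close>
  also have "(\<Sum>P\<in>?S. (-1) ^ size (conjugate_partition (pairs P))) =
      (\<Sum>P\<in>?S. (-1 :: int) ^ size (pairs P))"
    by (rule sum.reindex_bij_witness[where i = conjugate_pairs and j = conjugate_pairs])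
      (auto simp: pairs_conjugate_pairs conjugate_pairs_in_partitions_of,
       auto simp: partitions_of_def conjugate_pairs_involution)
  finally show ?thesis .
qed

subsection \<open>The sign-reversing involution\<close>

definition switchable :: "nat multiset \<Rightarrow> nat \<Rightarrow> bool" where
  "switchable P k \<longleftrightarrow> 2 \<le> count P k \<or> odd (count P (2 * k))"

text \<open>An unpaired \<open>2 * k\<close> takes precedence over a pair \<open>k, k\<close>. For
  \<open>k > 0\<close> each branch flips the parity of the multiplicity of \<open>2 * k\<close>, so
  a second application takes the other branch.\<close>

definition switch :: "nat \<Rightarrow> nat multiset \<Rightarrow> nat multiset" where
  "switch k P = (if odd (count P (2 * k)) then P - {#2 * k#} + {#k, k#}
     else P - {#k, k#} + {#2 * k#})"

text \<open>A common remainder \<open>R\<close> with an even multiplicity of \<open>2 * k\<close>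
  receives either the single part \<open>2 * k\<close> or the pair \<open>k, k\<close>. Only the
  latter adds an element to \<open>pairs\<close>, which flips the sign.\<close>

lemma switch_properties:
  assumes "switchable P k" "k > 0"
  shows "switch k (switch k P) = P"
    and "switchable (switch k P) k"
    and "j < k \<Longrightarrow> switchable (switch k P) j \<longleftrightarrow> switchable P j"
    and "sum_mset (switch k P) = sum_mset P"
    and "even (size (pairs (switch k P))) \<longleftrightarrow> odd (size (pairs P))"
    and "0 \<notin># P \<Longrightarrow> 0 \<notin># switch k P"
proof -
  consider
    (single) R where "P = R + {#2 * k#}" "switch k P = R + {#k, k#}" "even (count R (2 * k))"
  | (pair) R where "P = R + {#k, k#}" "switch k P = R + {#2 * k#}" "even (count R (2 * k))"
  proof (cases "odd (count P (2 * k))")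
    case True
    then have "2 * k \<in># P" by (metis even_zero not_in_iff)
    then obtain R where R: "P = R + {#2 * k#}" by (metis add_mset_add_single insert_DiffM)
    show ?thesis using True by (intro single[OF R]) (auto simp: R switch_def)
  next
    case False
    then have "2 \<le> count P k" using assms(1) by (simp add: switchable_def)
    then have "{#k, k#} \<subseteq># P" by (auto simp: subseteq_mset_def)
    then obtain R where R: "P = R + {#k, k#}" by (metis subset_mset.diff_add)
    show ?thesis using False assms(2) by (intro pair[OF R]) (auto simp: R switch_def)
  qed
  note cases = this
  have pairs_add: "pairs (add_mset k (add_mset k R)) = add_mset k (pairs R)" for R
    by (rule multiset_eqI) (auto simp: count_pairs)
  have pairs_add_single: "pairs (add_mset (2 * k) R) = pairs R" if "even (count R (2 * k))" for R
    using that by (intro multiset_eqI) (auto simp: count_pairs)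
  show "switch k (switch k P) = P"
    by (cases rule: cases) (use assms(2) in \<open>auto simp: switch_def\<close>)
  show "switchable (switch k P) k"
    by (cases rule: cases) (use assms(2) in \<open>auto simp: switchable_def\<close>)
  \<comment> \<open>Of the multiplicities of \<open>j\<close> and \<open>2 * j\<close>, only the
    latter can change, namely if \<open>2 * j = k\<close>, and then by 2, which keeps its
    parity.\<close>
  show "switchable (switch k P) j \<longleftrightarrow> switchable P j" if "j < k"
    by (cases rule: cases) (use that in \<open>auto simp: switchable_def\<close>)
  show "sum_mset (switch k P) = sum_mset P"
    by (cases rule: cases) auto
  show "even (size (pairs (switch k P))) \<longleftrightarrow> odd (size (pairs P))"
    by (cases rule: cases) (simp_all add: pairs_add pairs_add_single)
  show "0 \<notin># P \<Longrightarrow> 0 \<notin># switch k P"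
    by (cases rule: cases) (use assms(2) in auto)
qed

definition least_switch :: "nat multiset \<Rightarrow> nat multiset" where
  "least_switch P = switch (LEAST k. switchable P k) P"

lemma least_switch_properties:
  assumes "0 \<notin># P" "\<exists>k. switchable P k"
  shows "least_switch (least_switch P) = P"
    and "\<exists>k. switchable (least_switch P) k"
    and "0 \<notin># least_switch P"
    and "sum_mset (least_switch P) = sum_mset P"
    and "even (size (pairs (least_switch P))) \<longleftrightarrow> odd (size (pairs P))"
proof -
  define k where "k = (LEAST k. switchable P k)"
  have k: "switchable P k"
    unfolding k_def using assms(2) by (metis LeastI)
  have "\<not> switchable P 0" using assms(1) by (auto simp: switchable_def not_in_iff)
  with k have "k > 0" by (metis gr0I)
  note sw = switch_properties[OF k \<open>k > 0\<close>]
  have eq: "least_switch P = switch k P" by (simp add: least_switch_def k_def)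
  \<comment> \<open>\<open>k\<close> stays switchable and no smaller index becomes so; hence a
    second application uses the same \<open>k\<close>.\<close>
  have "(LEAST j. switchable (switch k P) j) = k"
  proof (rule Least_equality)
    fix j assume "switchable (switch k P) j"
    with sw(3)[of j] show "k \<le> j" unfolding k_def by (metis Least_le not_le)
  qed (rule sw(2))
  then show "least_switch (least_switch P) = P"
    by (subst least_switch_def) (simp add: eq sw(1))
  show "\<exists>k. switchable (least_switch P) k" "0 \<notin># least_switch P"
    "sum_mset (least_switch P) = sum_mset P"
    "even (size (pairs (least_switch P))) \<longleftrightarrow> odd (size (pairs P))"
    using sw assms by (auto simp: eq)
qed

lemma signed_sum_eq_card:
  "(\<Sum>P\<in>partitions_of n. (-1) ^ size (pairs P)) =
     int (card {P \<in> partitions_of n. \<forall>k. \<not> switchable P k})"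
proof -
  let ?B = "{P \<in> partitions_of n. \<exists>k. switchable P k}"
  let ?F = "{P \<in> partitions_of n. \<forall>k. \<not> switchable P k}"
  let ?f = "\<lambda>P. (-1 :: int) ^ size (pairs P)"
  \<comment> \<open>Reindexing by the involution negates every term, so the sum equals its own
    negative.\<close>
  have "sum ?f ?B = (\<Sum>P\<in>?B. - ?f P)"
    by (rule sum.reindex_bij_witness[where i = least_switch and j = least_switch])
      (auto simp: partitions_of_def least_switch_properties minus_one_power_iff)
  then have B: "sum ?f ?B = 0" by (simp add: sum_negf)
  have "pairs P = {#}" if "\<forall>k. \<not> switchable P k" for P
    by (rule multiset_eqI) (use that in \<open>auto simp: count_pairs switchable_def not_le\<close>)
  then have F: "sum ?f ?F = int (card ?F)" by simp
  have "partitions_of n = ?B \<union> ?F" by auto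
  then have "sum ?f (partitions_of n) = sum ?f ?B + sum ?f ?F"
    using sum.union_disjoint[of ?B ?F ?f] finite_partitions_of[of n] by auto
  with B F show ?thesis by simp
qed

subsection \<open>Diagonal hooks\<close>

text \<open>
  Symmetric diagrams are encoded by the set \<open>A\<close> of arm lengths of their diagonal cells, a hook
  with arm \<open>a\<close> having \<open>2a + 1\<close> cells. The \<open>d\<close>-th diagonal meets exactly the hooks with arm at
  least \<open>d\<close>.
\<close>

definition arm_sets :: "nat \<Rightarrow> nat set set" where
  "arm_sets n = {A. finite A \<and> (\<Sum>a\<in>A. 2 * a + 1) = n}"

text \<open>\<open>max i j - min i j\<close> is the distance of the cell from the main diagonal and
  \<open>min i j\<close> its position along its own diagonal.\<close>

definition hook_diagram :: "nat set \<Rightarrow> (nat \<times> nat) set" where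
  "hook_diagram A = {(i, j). min i j < card {a \<in> A. max i j - min i j \<le> a}}"

lemma hook_diagram_symmetric: "(hook_diagram A)\<inverse> = hook_diagram A"
  by (auto simp: hook_diagram_def min.commute max.commute)

text \<open>Neighbouring diagonals differ by at most one cell, and whether they differ records if
  \<open>d\<close> is an arm. The first fact yields down-closure, the second injectivity.\<close>

lemma card_arms_Suc:
  assumes "finite A"
  shows "card {a \<in> A. d \<le> a} = (if d \<in> A then 1 else 0) + card {a \<in> A. Suc d \<le> a}"
proof (cases "d \<in> A")
  case True
  then have "{a \<in> A. d \<le> a} = insert d {a \<in> A. Suc d \<le> a}" by auto
  with True show ?thesis using assms by simp
next
  case False
  then have "{a \<in> A. d \<le> a} = {a \<in> A. Suc d \<le> a}" by (auto simp: Suc_le_eq le_less)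
  with False show ?thesis by simp
qed

lemma hook_diagram_upper: "(i, i + d) \<in> hook_diagram A \<longleftrightarrow> i < card {a \<in> A. d \<le> a}"
  by (simp add: hook_diagram_def)

lemma down_closed_hook_diagram:
  assumes "finite A"
  shows "down_closed (hook_diagram A)"
proof -
  let ?c = "\<lambda>d. card {a \<in> A. d \<le> a}"
  have anti: "?c e \<le> ?c d" if "d \<le> e" for d e
    using assms that by (intro card_mono) auto
  have drop: "?c d \<le> ?c (d + e) + e" for d e
  proof (induction e)
    case (Suc e)
    then show ?case using card_arms_Suc[OF assms, of "d + e"] by (auto split: if_splits)
  qed simp
  show ?thesis
    unfolding down_closed_def hook_diagram_def
  proof clarify
    fix i j i' j' :: nat
    define m M m' M' where "m = min i j" "M = max i j" "m' = min i' j'" "M' = max i' j'"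
    assume "min i j < ?c (max i j - min i j)" and le: "i' \<le> i" "j' \<le> j"
    then have *: "m < ?c (M - m)" by (simp add: m_M_m'_M'_def)
    have le': "m' \<le> m" "M' \<le> M" "m \<le> M" "m' \<le> M'"
      using le by (auto simp: m_M_m'_M'_def)
    \<comment> \<open>Two stages: lowering \<open>m\<close> to \<open>m'\<close> moves the diagonal
      outwards and costs at most one cell per step; lowering \<open>M\<close> to \<open>M'\<close>
      moves it inwards and costs none.\<close>
    have "?c (M - m) \<le> ?c (M - m + (m - m')) + (m - m')" by (rule drop)
    also have "M - m + (m - m') = M - m'" using le' by simp
    also have "?c (M - m') \<le> ?c (M' - m')" by (rule anti) (use le' in simp)
    finally have "m' < ?c (M' - m')" using * le' by linarith
    then show "min i' j' < ?c (max i' j' - min i' j')" by (simp add: m_M_m'_M'_def)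
  qed
qed

text \<open>Cells are counted along signed diagonals \<open>z = j - i\<close>. After exchanging the
  sums, each arm \<open>a\<close> is counted once for every \<open>z\<close> with absolute value at
  most \<open>a\<close>, hence \<open>2 * a + 1\<close> times.\<close>

lemma card_hook_diagram:
  assumes "finite A"
  shows "finite (hook_diagram A)" and "card (hook_diagram A) = (\<Sum>a\<in>A. 2 * a + 1)"
proof -
  \<comment> \<open>A bound on all arms, so that diagonals outside \<open>{-N..N}\<close> are
    empty.\<close>
  define N where "N = int (Max (insert 0 A))"
  have N: "int a \<le> N" if "a \<in> A" for a
    using assms that by (simp add: N_def)
  let ?c = "\<lambda>z. card {a \<in> A. nat \<bar>z\<bar> \<le> a}"
  let ?T = "Sigma {-N..N} (\<lambda>z. {..<?c z})"
  have bij: "bij_betw (\<lambda>(i, j). (int j - int i, min i j)) (hook_diagram A) ?T"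
  proof (rule bij_betw_byWitness[where
        f' = "\<lambda>(z, m). (m + nat (- z), m + nat z)"])
    have eq: "nat \<bar>int j - int i\<bar> = max i j - min i j" for i j by auto
    have "(int j - int i, min i j) \<in> ?T" if "(i, j) \<in> hook_diagram A" for i j
    proof -
      from that have "min i j < ?c (int j - int i)" by (simp add: hook_diagram_def eq)
      moreover from this have "{a \<in> A. nat \<bar>int j - int i\<bar> \<le> a} \<noteq> {}"
        by (metis card.empty not_less_zero)
      then obtain a where "a \<in> A" "nat \<bar>int j - int i\<bar> \<le> a" by auto
      with N[of a] have "int j - int i \<in> {-N..N}" by auto
      ultimately show ?thesis by simp
    qed
    then show "(\<lambda>(i, j). (int j - int i, min i j)) ` hook_diagram A \<subseteq> ?T"
      by (intro image_subsetI) (simp only: split_paired_all case_prod_conv)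
    have "(m + nat (- z), m + nat z) \<in> hook_diagram A" if "m < ?c z" for z m
    proof -
      note that
      moreover have "min (m + nat (- z)) (m + nat z) = m"
        "max (m + nat (- z)) (m + nat z) - m = nat \<bar>z\<bar>" by auto
      ultimately show ?thesis
        by (simp add: hook_diagram_def)
    qed
    then show "(\<lambda>(z, m). (m + nat (- z), m + nat z)) ` ?T \<subseteq> hook_diagram A" by auto
  qed auto
  show "finite (hook_diagram A)"
    using bij_betw_finite[OF bij] by simp
  have "card (hook_diagram A) = (\<Sum>z\<in>{-N..N}. ?c z)"
    using bij_betw_same_card[OF bij] by simp
  also have "\<dots> = (\<Sum>z\<in>{-N..N}. \<Sum>a\<in>A. if nat \<bar>z\<bar> \<le> a then 1 else 0)"
    using assms by (simp add: sum.If_cases Collect_conj_eq Int_commute)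
  also have "\<dots> = (\<Sum>a\<in>A. \<Sum>z\<in>{-N..N}. if nat \<bar>z\<bar> \<le> a then 1 else 0)"
    by (rule sum.swap)
  also have "\<dots> = (\<Sum>a\<in>A. 2 * a + 1)"
  proof (rule sum.cong)
    fix a assume "a \<in> A"
    then have "{-N..N} \<inter> {z. nat \<bar>z\<bar> \<le> a} = {- int a..int a}" using N[of a] by auto
    then show "(\<Sum>z\<in>{-N..N}. if nat \<bar>z\<bar> \<le> a then 1 else 0) = 2 * a + 1"
      by (simp add: sum.If_cases)
  qed simp
  finally show "card (hook_diagram A) = (\<Sum>a\<in>A. 2 * a + 1)" .
qed

lemma hook_diagram_inject:
  assumes "finite A" "finite B" "hook_diagram A = hook_diagram B"
  shows "A = B"
proof -
  have card_eq: "card {a \<in> A. d \<le> a} = card {a \<in> B. d \<le> a}" for d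
    using hook_diagram_upper[of _ d A] hook_diagram_upper[of _ d B] assms(3)
    by (metis linorder_neqE_nat less_irrefl)
  have "d \<in> A \<longleftrightarrow> d \<in> B" for d
    using card_arms_Suc[OF assms(1), of d] card_arms_Suc[OF assms(2), of d]
      card_eq[of d] card_eq[of "Suc d"] by (simp split: if_splits)
  then show ?thesis by blast
qed

text \<open>Distinct diagonal cells have distinct arms, so the number of arms at least
  \<open>d\<close> is the number of cells on the \<open>d\<close>-th diagonal. This settles the
  upper half, and symmetry the lower.\<close>

lemma symmetric_eq_hook_diagram:
  assumes "finite Y" "down_closed Y" "Y\<inverse> = Y"
  obtains A where "finite A" "Y = hook_diagram A"
proof -
  define arm where "arm i = card {j. (i, j) \<in> Y} - Suc i" for i
  define I where "I = {i. (i, i) \<in> Y}"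
  define A where "A = arm ` I"
  have "I \<subseteq> fst ` Y" by (force simp: I_def)
  then have fin: "finite I" using assms(1) finite_subset by blast
  \<comment> \<open>The conjunct \<open>i \<in> I\<close> is essential at \<open>d = 0\<close>:
    truncated subtraction makes \<open>arm i\<close> equal 0 for rows that miss the
    diagonal.\<close>
  have arm_iff: "i \<in> I \<and> d \<le> arm i \<longleftrightarrow> (i, i + d) \<in> Y" for i d
  proof -
    have "i \<in> I \<longleftrightarrow> i < card {j. (i, j) \<in> Y}"
      by (simp add: less_card_row_iff[OF assms(1,2)] I_def)
    moreover have "(i, i + d) \<in> Y \<longleftrightarrow> i + d < card {j. (i, j) \<in> Y}"
      by (simp add: less_card_row_iff[OF assms(1,2)])
    ultimately show ?thesis by (auto simp: arm_def)
  qed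
  have arm_less: "arm i' < arm i" if "i < i'" "i' \<in> I" for i i'
  proof -
    have "(i', i' + arm i') \<in> Y" using arm_iff that(2) by blast
    \<comment> \<open>As \<open>i < i'\<close>, also
      \<open>i + Suc (arm i') \<le> i' + arm i'\<close>, so down-closure makes the arm of row
      \<open>i\<close> longer by at least one.\<close>
    then have "(i, i + Suc (arm i')) \<in> Y" by (rule down_closedD[OF assms(2)]) (use that in auto)
    then show ?thesis using arm_iff[of i "Suc (arm i')"] by simp
  qed
  then have inj: "inj_on arm I"
    by (intro linorder_inj_onI') (metis less_irrefl)
  have card_eq: "card {a \<in> A. d \<le> a} = card {i. (i, i + d) \<in> Y}" for d
  proof -
    have "{a \<in> A. d \<le> a} = arm ` {i. (i, i + d) \<in> Y}"
      using arm_iff[of _ d] by (auto simp: A_def)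
    moreover have "inj_on arm {i. (i, i + d) \<in> Y}"
      by (rule inj_on_subset[OF inj]) (use arm_iff in blast)
    ultimately show ?thesis by (simp add: card_image)
  qed
  have upper: "(i, i + d) \<in> Y \<longleftrightarrow> (i, i + d) \<in> hook_diagram A" for i d
  proof -
    have "{i. (i, i + d) \<in> Y} \<subseteq> I" using arm_iff by blast
    then have "finite {i. (i, i + d) \<in> Y}" using fin finite_subset by blast
    then have "i < card {i. (i, i + d) \<in> Y} \<longleftrightarrow> i \<in> {i. (i, i + d) \<in> Y}"
      by (rule initial_segment_iff) (auto intro: down_closedD[OF assms(2)])
    then show ?thesis by (simp add: hook_diagram_upper card_eq)
  qed
  have "(i, j) \<in> Y \<longleftrightarrow> (i, j) \<in> hook_diagram A" for i j
  proof (cases "i \<le> j")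
    case True
    then show ?thesis using upper[of i "j - i"] by simp
  next
    case False
    then have "(j, i) \<in> Y \<longleftrightarrow> (j, i) \<in> hook_diagram A" using upper[of j "i - j"] by simp
    then show ?thesis using assms(3) hook_diagram_symmetric[of A] by (metis converse_iff)
  qed
  then have "Y = hook_diagram A" by auto
  moreover have "finite A" using fin by (simp add: A_def)
  ultimately show ?thesis using that by blast
qed

section \<open>Counting both families by arm sets\<close>

lemma self_conjugate_count_eq_arm_sets: "self_conjugate_count n = card (arm_sets n)"
proof -
  have "bij_betw (\<lambda>A. row_partition (hook_diagram A)) (arm_sets n)
      {P \<in> partitions_of n. conjugate_partition P = P}"
  proof (rule bij_betw_imageI)
    have diag: "diagram (row_partition (hook_diagram A)) = hook_diagram A" if "finite A" for A
      using that by (simp add: diagram_row_partition card_hook_diagram down_closed_hook_diagram)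
    show "inj_on (\<lambda>A. row_partition (hook_diagram A)) (arm_sets n)"
      by (rule inj_onI) (metis (mono_tags, lifting) arm_sets_def diag hook_diagram_inject
          mem_Collect_eq)
    show "(\<lambda>A. row_partition (hook_diagram A)) ` arm_sets n =
        {P \<in> partitions_of n. conjugate_partition P = P}"
    proof (intro equalityI subsetI)
      fix P
      assume "P \<in> (\<lambda>A. row_partition (hook_diagram A)) ` arm_sets n"
      then obtain A where A: "finite A" "(\<Sum>a\<in>A. 2 * a + 1) = n"
        "P = row_partition (hook_diagram A)"
        by (auto simp: arm_sets_def)
      then have "P \<in> partitions_of n"
        using card_hook_diagram[OF A(1)] down_closed_hook_diagram[OF A(1)]
        by (simp add: partitions_of_def zero_notin_row_partition sum_row_partition)
      moreover have "conjugate_partition P = P"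
        unfolding conjugate_partition_eq using A diag hook_diagram_symmetric by simp
      ultimately show "P \<in> {P \<in> partitions_of n. conjugate_partition P = P}" by simp
    next
      fix P
      assume "P \<in> {P \<in> partitions_of n. conjugate_partition P = P}"
      then have P: "0 \<notin># P" "sum_mset P = n" "conjugate_partition P = P"
        by (auto simp: partitions_of_def)
      then have "(diagram P)\<inverse> = diagram P" using diagram_conjugate_partition[of P] by simp
      then obtain A where A: "finite A" "diagram P = hook_diagram A"
        using symmetric_eq_hook_diagram[OF finite_diagram down_closed_diagram] by blast
      then have "A \<in> arm_sets n"
        using card_diagram[OF P(1)] card_hook_diagram[OF A(1)] P(2) by (simp add: arm_sets_def)
      moreover have "P = row_partition (hook_diagram A)"
        using row_partition_diagram[OF P(1)] A(2) by simp
      ultimately show "P \<in> (\<lambda>A. row_partition (hook_diagram A)) ` arm_sets n" by blast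
    qed
  qed
  then show ?thesis
    by (simp add: self_conjugate_count_def bij_betw_same_card)
qed

text \<open>Without switches every multiplicity is below 2, and that of an even part is also even,
  hence 0. What remains are sets of odd parts \<open>2 * a + 1\<close>.\<close>

lemma not_switchable_count_eq_arm_sets:
  "card {P \<in> partitions_of n. \<forall>k. \<not> switchable P k} = card (arm_sets n)"
proof -
  let ?h = "\<lambda>a. 2 * a + 1 :: nat"
  let ?f = "\<lambda>A. mset_set (?h ` A)"
  have inj: "inj_on ?h A" for A by (rule inj_onI) simp
  \<comment> \<open>For infinite \<open>A\<close> both sides default to 0.\<close>
  have sum_f: "sum_mset (?f A) = (\<Sum>a\<in>A. 2 * a + 1)" for A
    using sum.reindex[OF inj, of "\<lambda>x. x" A] sum_unfold_sum_mset[of "\<lambda>x. x" "?h ` A"]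
    by (simp add: comp_def)
  have "bij_betw ?f (arm_sets n) {P \<in> partitions_of n. \<forall>k. \<not> switchable P k}"
  proof (rule bij_betw_imageI)
    show "inj_on ?f (arm_sets n)"
    proof (rule inj_onI)
      fix A B
      assume "A \<in> arm_sets n" "B \<in> arm_sets n" "?f A = ?f B"
      \<comment> \<open>Finiteness matters here: \<open>mset_set\<close> sends every infinite set to
        the empty multiset.\<close>
      then have "?h ` A = ?h ` B"
        by (metis (mono_tags, lifting) arm_sets_def finite_imageI finite_set_mset_mset_set
            mem_Collect_eq)
      then show "A = B" using inj[of UNIV] by (simp add: inj_image_eq_iff)
    qed
    show "?f ` arm_sets n = {P \<in> partitions_of n. \<forall>k. \<not> switchable P k}"
    proof (intro equalityI subsetI)
      fix P
      assume "P \<in> ?f ` arm_sets n"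
      then obtain A where A: "finite A" "(\<Sum>a\<in>A. 2 * a + 1) = n" "P = ?f A"
        by (auto simp: arm_sets_def)
      have "sum_mset P = n"
        using A sum_f[of A] by simp
      moreover have "0 \<notin># P" using A by auto
      moreover have "\<not> switchable P k" for k
      proof -
        have "2 * k \<notin> ?h ` A" by (auto, presburger)
        then show ?thesis using A by (simp add: switchable_def count_mset_set')
      qed
      ultimately show "P \<in> {P \<in> partitions_of n. \<forall>k. \<not> switchable P k}"
        by (simp add: partitions_of_def)
    next
      fix P
      assume "P \<in> {P \<in> partitions_of n. \<forall>k. \<not> switchable P k}"
      then have P: "0 \<notin># P" "sum_mset P = n" "\<And>k. count P k < 2" "\<And>k. even (count P (2 * k))"
        by (auto simp: partitions_of_def switchable_def not_le)
      define A where "A = {a. ?h a \<in># P}"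
      have odd_part: "odd k" if "k \<in># P" for k
      proof
        assume "even k"
        then have "even (count P k)" using P(4)[of "k div 2"] by simp
        with P(3)[of k] have "count P k = 0" by presburger
        with that show False by (metis not_in_iff)
      qed
      have img: "?h ` A = set_mset P"
      proof (intro equalityI subsetI)
        fix k assume "k \<in># P"
        with odd_part obtain a where "k = 2 * a + 1" by (metis oddE)
        with \<open>k \<in># P\<close> show "k \<in> ?h ` A" by (auto simp: A_def)
      qed (auto simp: A_def)
      have fin: "finite A" using img inj[of A] finite_imageD by (metis finite_set_mset)
      have fA: "?f A = P"
      proof (rule multiset_eqI)
        fix k
        have "k \<in># P \<Longrightarrow> count P k = 1"
          using P(3)[of k] count_greater_zero_iff[of P k] by linarith
        then show "count (?f A) k = count P k"
          unfolding img by (auto simp: count_mset_set' not_in_iff)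
      qed
      have "A \<in> arm_sets n" using sum_f[of A] fA P(2) fin by (simp add: arm_sets_def)
      with fA show "P \<in> ?f ` arm_sets n" by blast
    qed
  qed
  then show ?thesis by (simp add: bij_betw_same_card)
qed

theorem theorem3p1:
  fixes n :: nat
  shows "int (even_rank_count n) - int (odd_rank_count n) = (-1) ^ n * int (self_conjugate_count n)"
  by (simp only: even_minus_odd_rank_count signed_sum_eq_card not_switchable_count_eq_arm_sets
      self_conjugate_count_eq_arm_sets)

end
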